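(* If $\mathcal{R}$ is any second order rational approximation to a quadratic irrational $\alpha\in\mathbb{R}$ with $\gamma_1=0$, then $\mathcal{R}$ is actually an infinite order rational approximation to $\alpha$, and there exist $a,b,c,d\in\mathbb{Z}$ such that \[ ar^2+brs+cs^2=d \] for all but finitely many $(r,s)\in\mathcal{R}$.
   Context: A quadratic irrational is an irrational real number that is a root of a quadratic polynomial with integer coefficients. Definition. For $N\in\mathbb{N}$, an order $N$ rational approximation of $\alpha\in\mathbb{R}$ is an infinite subset $\mathcal{R}\subset\mathbb{Z}^2$ such that there exist real numbers $\gamma_1,\dots,\gamma_N$ (uniquely determined by $\mathcal{R}$) for which \[ \frac{r}{s}=\alpha+\gamma_1 s^{-1}+\gamma_2 s^{-2}+\dots+\gamma_N s^{-N}+o\left([|r|+|s|]^{-N}\right) \] as $|r|+|s|\to\infty$ with $(r,s)\in\mathcal{R}$. (The condition is asymptotic; it presupposes $s\ne0$ for all but finitely many $(r,s)\in\mathcal{R}$.) "Second order" means $N=2$; the $\gamma_1$ in the claim is the coefficient in this expansion. An infinite order rational approximation of $\alpha$ is a subset $\mathcal{R}$ satisfying this condition for every $N\in\mathbb{N}$. *)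

theory Defs
  imports Complex_Main "HOL-Library.Landau_Symbols" "HOL-Computational_Algebra.Polynomial"
begin

definition quadratic_irrational :: "real \<Rightarrow> bool" where
  "quadratic_irrational \<alpha> \<longleftrightarrow>
     \<alpha> \<notin> \<rat> \<and> (\<exists>p :: int poly. degree p = 2 \<and> poly (map_poly real_of_int p) \<alpha> = 0)"

text \<open>The limit \<open>|r| + |s| \<rightarrow> \<infinity>\<close> with \<open>(r, s)\<close> ranging over \<open>R\<close>.\<close>

definition approx_filter :: "(int \<times> int) set \<Rightarrow> (int \<times> int) filter" where
  "approx_filter R = inf (filtercomap (\<lambda>(r, s). \<bar>r\<bar> + \<bar>s\<bar>) at_top) (principal R)"

text \<open>
  Only the values \<open>\<gamma> 1, \<dots>, \<gamma> N\<close> matter. Since division by zero yields zero in HOL,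
  the requirement that \<open>s \<noteq> 0\<close> for all but finitely many pairs is made explicit.
\<close>

definition has_rational_expansion ::
    "nat \<Rightarrow> (nat \<Rightarrow> real) \<Rightarrow> real \<Rightarrow> (int \<times> int) set \<Rightarrow> bool" where
  "has_rational_expansion N \<gamma> \<alpha> R \<longleftrightarrow>
     infinite R \<and>
     finite {(r, s) \<in> R. s = 0} \<and>
     (\<lambda>(r, s). of_int r / of_int s - (\<alpha> + (\<Sum>k=1..N. \<gamma> k / of_int s ^ k)))
       \<in> o[approx_filter R](\<lambda>(r, s). 1 / (real_of_int (\<bar>r\<bar> + \<bar>s\<bar>)) ^ N)"

definition rational_approximation :: "nat \<Rightarrow> real \<Rightarrow> (int \<times> int) set \<Rightarrow> bool" where
  "rational_approximation N \<alpha> R \<longleftrightarrow> (\<exists>\<gamma>. has_rational_expansion N \<gamma> \<alpha> R)"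

text \<open>
  The order \<open>N = 0\<close> is included; it only says \<open>r / s \<rightarrow> \<alpha>\<close>, which already follows from order 1.
\<close>

definition infinite_order_rational_approximation :: "real \<Rightarrow> (int \<times> int) set \<Rightarrow> bool" where
  "infinite_order_rational_approximation \<alpha> R \<longleftrightarrow> (\<forall>N. rational_approximation N \<alpha> R)"

end

theory Submission imports Defs begin

text \<open>
  Let \<open>a x\<^sup>2 + b x + c\<close> vanish at \<open>\<alpha>\<close> and put \<open>D = 2 a \<alpha> + b\<close>, which is nonzero as \<open>\<alpha>\<close> is irrational.
  With \<open>u = r / s - \<alpha>\<close> one has \<open>a r\<^sup>2 + b r s + c s\<^sup>2 = s\<^sup>2 (D u + a u\<^sup>2)\<close>. Since \<open>\<gamma> 1 = 0\<close>,
  this converges to \<open>D \<gamma> 2\<close>; being an integer, it is eventually constant, say \<open>d\<close>.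
  Then \<open>u = (d / s\<^sup>2 - a u\<^sup>2) / D\<close> eventually, and iterating this identity
  expands \<open>u\<close> in powers of \<open>1 / s\<close> to any order.
\<close>

text \<open>Only finitely many integer pairs have bounded
  \<open>\<bar>r\<bar> + \<bar>s\<bar>\<close>, and a finite set has bounded height. So this limit
  is the cofinite one on \<open>R\<close>, which links asymptotic statements to "all but finitely
  many".\<close>

lemma eventually_approx_filter_iff:
  "eventually P (approx_filter R) \<longleftrightarrow> finite {x \<in> R. \<not> P x}"
proof
  assume "eventually P (approx_filter R)"
  then obtain Q n where "\<forall>m\<ge>n. Q m"
    and "\<forall>x. Q (case x of (r, s) \<Rightarrow> \<bar>r\<bar> + \<bar>s\<bar>) \<longrightarrow> x \<in> R \<longrightarrow> P x"
    unfolding approx_filter_def eventually_inf_principal eventually_filtercomap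
      eventually_at_top_linorder by blast
  then have n: "P (r, s)" if "(r, s) \<in> R" "\<bar>r\<bar> + \<bar>s\<bar> \<ge> n" for r s
    using that by auto
  have "{x \<in> R. \<not> P x} \<subseteq> {-\<bar>n\<bar>..\<bar>n\<bar>} \<times> {-\<bar>n\<bar>..\<bar>n\<bar>}"
  proof
    fix x assume "x \<in> {x \<in> R. \<not> P x}"
    moreover obtain r s where "x = (r, s)" by fastforce
    ultimately have "\<not> \<bar>r\<bar> + \<bar>s\<bar> \<ge> n" using n by blast
    then show "x \<in> {-\<bar>n\<bar>..\<bar>n\<bar>} \<times> {-\<bar>n\<bar>..\<bar>n\<bar>}" using \<open>x = (r, s)\<close> by auto
  qed
  then show "finite {x \<in> R. \<not> P x}" by (rule finite_subset) simp
next
  assume fin: "finite {x \<in> R. \<not> P x}"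
  define g :: "int \<times> int \<Rightarrow> int" where "g = (\<lambda>(r, s). \<bar>r\<bar> + \<bar>s\<bar>)"
  have "bdd_above (g ` {x \<in> R. \<not> P x})"
    using fin by (intro bdd_above_finite finite_imageI)
  then obtain M where M: "\<And>x. x \<in> R \<Longrightarrow> \<not> P x \<Longrightarrow> g x \<le> M"
    unfolding bdd_above_def by auto
  have "eventually (\<lambda>y. y > M) at_top" by (rule eventually_gt_at_top)
  moreover have "\<And>x. g x > M \<Longrightarrow> x \<in> R \<longrightarrow> P x" using M by (meson not_le)
  ultimately show "eventually P (approx_filter R)"
    unfolding approx_filter_def eventually_inf_principal eventually_filtercomap g_def by blast
qed

lemma tendsto_inverse_height:
  "((\<lambda>(r, s). 1 / real_of_int (\<bar>r\<bar> + \<bar>s\<bar>)) \<longlongrightarrow> 0) (approx_filter R)"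
proof -
  have "filterlim (\<lambda>(r, s). \<bar>r\<bar> + \<bar>s\<bar> :: int) at_top (approx_filter R)"
    unfolding approx_filter_def
    by (rule filterlim_mono[OF filterlim_filtercomap order.refl inf_le1])
  then have "filterlim (\<lambda>x. real_of_int ((\<lambda>(r, s). \<bar>r\<bar> + \<bar>s\<bar>) x)) at_top (approx_filter R)"
    by (rule filterlim_compose[OF filterlim_real_of_int_at_top])
  then have "((\<lambda>x. 1 / real_of_int ((\<lambda>(r, s). \<bar>r\<bar> + \<bar>s\<bar>) x)) \<longlongrightarrow> 0) (approx_filter R)"
    by (intro tendsto_divide_0[OF tendsto_const] filterlim_at_top_imp_at_infinity)
  then show ?thesis by (simp add: case_prod_unfold)
qed

text \<open>Two integers within 1/2 of the same real \<open>L\<close> differ by less than 1, so they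
  are equal.\<close>

lemma tendsto_of_int_eventually_const:
  fixes q :: "'a \<Rightarrow> int"
  assumes "((\<lambda>t. real_of_int (q t)) \<longlongrightarrow> L) F"
  obtains d where "eventually (\<lambda>t. q t = d) F"
proof -
  have ev: "eventually (\<lambda>t. \<bar>real_of_int (q t) - L\<bar> < 1/2) F"
    using tendstoD[OF assms, of "1/2"] by (simp add: dist_real_def)
  show thesis
  proof (cases "\<exists>t0. \<bar>real_of_int (q t0) - L\<bar> < 1/2")
    case True
    then obtain t0 where t0: "\<bar>real_of_int (q t0) - L\<bar> < 1/2" by blast
    have "q t = q t0" if "\<bar>real_of_int (q t) - L\<bar> < 1/2" for t
      using that t0 by linarith
    then show thesis using ev that by (metis (mono_tags, lifting) eventually_mono)
  next
    \<comment> \<open>Here an impossible property holds eventually, so \<open>F\<close> is trivial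
      and any value of \<open>d\<close> would do.\<close>
    case False
    then have "eventually (\<lambda>t. q t = 0) F" using ev by (auto elim: eventually_mono)
    then show thesis by (rule that)
  qed
qed

lemma poly_bigo_1:
  fixes x :: "'a \<Rightarrow> real"
  assumes "(x \<longlongrightarrow> 0) F"
  shows "(\<lambda>t. poly P (x t)) \<in> O[F](\<lambda>_. 1)"
proof -
  have "((\<lambda>t. poly P (x t)) \<longlongrightarrow> poly P 0) F"
    using assms by (intro tendsto_intros)
  then show ?thesis by (intro bigoI_tendsto[where c = "poly P 0"]) simp_all
qed

text \<open>The terms of degree at least \<open>n\<close> factor as \<open>x t ^ n\<close> times a
  polynomial in \<open>x t\<close>, which is bounded because \<open>x\<close> tends to 0.\<close>

lemma poly_minus_cutoff_bigo:
  fixes x :: "'a \<Rightarrow> real"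
  assumes "(x \<longlongrightarrow> 0) F"
  shows "(\<lambda>t. poly P (x t) - poly (poly_cutoff n P) (x t)) \<in> O[F](\<lambda>t. x t ^ n)"
proof -
  have "P = poly_cutoff n P + monom 1 n * poly_shift n P"
    by (rule poly_eqI) (simp add: coeff_poly_cutoff coeff_poly_shift coeff_monom_mult)
  then have "poly P y - poly (poly_cutoff n P) y = y ^ n * poly (poly_shift n P) y" for y
    by (metis add_diff_cancel_left' mult_1 poly_add poly_monom poly_mult)
  then show ?thesis
    using landau_o.big.mult[OF landau_o.big_refl[of "\<lambda>t. x t ^ n"] poly_bigo_1[OF assms]] by simp
qed

text \<open>Fixed-point iteration for u = (e x^2 - a u^2) / D. Replacing u by an approximation P on
  the right changes u^2 by (u + P)(u - P), and u + P = O(x), so each round gains one power of x. The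
  condition on \<open>coeff P 0\<close> is what makes P(x) = O(x).\<close>

lemma quadratic_solution_expansion:
  fixes u x :: "'a \<Rightarrow> real"
  assumes x: "(x \<longlongrightarrow> 0) F" and u: "u \<in> O[F](x)" and "D \<noteq> 0"
    and eq: "eventually (\<lambda>t. a * u t ^ 2 + D * u t = e * x t ^ 2) F"
  shows "\<exists>P. coeff P 0 = 0 \<and> (\<lambda>t. u t - poly P (x t)) \<in> O[F](\<lambda>t. x t ^ Suc n)"
proof (induction n)
  case 0
  show ?case using u by (intro exI[of _ 0]) simp
next
  case (Suc n)
  then obtain P where P0: "coeff P 0 = 0"
    and P: "(\<lambda>t. u t - poly P (x t)) \<in> O[F](\<lambda>t. x t ^ Suc n)" by blast
  \<comment> \<open>The right-hand side of the fixed-point equation, with \<open>P\<close> in place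
    of u.\<close>
  define Q where "Q = smult (1 / D) (monom e 2 - smult a (P * P))"
  have "coeff Q 0 = 0" by (simp add: Q_def coeff_mult_0 P0)
  have "poly_cutoff 1 P = 0"
    by (rule poly_eqI) (simp add: coeff_poly_cutoff P0)
  then have "(\<lambda>t. poly P (x t)) \<in> O[F](x)"
    using poly_minus_cutoff_bigo[OF x, of P 1] by simp
  then have "(\<lambda>t. u t + poly P (x t)) \<in> O[F](x)" using u by (rule sum_in_bigo(1)[rotated])
  from landau_o.big.mult[OF this P]
  have "(\<lambda>t. - a / D * ((u t + poly P (x t)) * (u t - poly P (x t)))) \<in> O[F](\<lambda>t. x t ^ Suc (Suc n))"
    using \<open>D \<noteq> 0\<close> by (cases "a = 0") simp_all
  moreover have "eventually (\<lambda>t. - a / D * ((u t + poly P (x t)) * (u t - poly P (x t)))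
      = u t - poly Q (x t)) F"
    using eq
  proof eventually_elim
    case (elim t)
    have "D * (u t - poly Q (x t)) = D * u t - e * x t ^ 2 + a * (poly P (x t))\<^sup>2"
      using \<open>D \<noteq> 0\<close> by (simp add: Q_def poly_monom field_simps power2_eq_square)
    also have "\<dots> = - a * ((u t + poly P (x t)) * (u t - poly P (x t)))"
      using elim by (simp add: algebra_simps power2_eq_square)
    finally show ?case using \<open>D \<noteq> 0\<close> by (simp add: field_simps)
  qed
  ultimately have "(\<lambda>t. u t - poly Q (x t)) \<in> O[F](\<lambda>t. x t ^ Suc (Suc n))"
    by (rule landau_o.big.in_cong[THEN iffD1, rotated])
  with \<open>coeff Q 0 = 0\<close> show ?case by blast
qed

text \<open>The last property says that the derivative of the quadratic does not vanish at \<alpha>: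
  otherwise \<alpha> would be the rational number -b / (2a).\<close>

lemma quadratic_irrational_root:
  fixes \<alpha> :: real
  assumes "quadratic_irrational \<alpha>"
  obtains a b c :: int where "a \<noteq> 0" "a * \<alpha>\<^sup>2 + b * \<alpha> + c = 0" "2 * a * \<alpha> + b \<noteq> 0"
proof -
  from assms obtain p :: "int poly" where irr: "\<alpha> \<notin> \<rat>" and deg: "degree p = 2"
    and root: "poly (map_poly real_of_int p) \<alpha> = 0"
    unfolding quadratic_irrational_def by blast
  define a b c where "a = coeff p 2" and "b = coeff p 1" and "c = coeff p 0"
  have "a \<noteq> 0" using deg unfolding a_def by (metis degree_0 leading_coeff_0_iff zero_neq_numeral)
  moreover have "a * \<alpha>\<^sup>2 + b * \<alpha> + c = 0"
    using root deg unfolding a_def b_def c_def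
    by (simp add: poly_altdef degree_map_poly coeff_map_poly numeral_2_eq_2)
  moreover have "2 * a * \<alpha> + b \<noteq> 0"
  proof
    assume "2 * a * \<alpha> + b = 0"
    then have "\<alpha> = of_int (- b) / of_int (2 * a)"
      using \<open>a \<noteq> 0\<close> by (simp add: field_simps)
    then show False using irr by (metis Rats_divide Rats_of_int)
  qed
  ultimately show thesis by (rule that)
qed

theorem theorem4p2:
  fixes \<alpha> :: real and R :: "(int \<times> int) set" and \<gamma> :: "nat \<Rightarrow> real"
  assumes "quadratic_irrational \<alpha>"
    and "has_rational_expansion 2 \<gamma> \<alpha> R"
    and "\<gamma> 1 = 0"
  shows "infinite_order_rational_approximation \<alpha> R \<and>
    (\<exists>a b c d :: int. (a, b, c) \<noteq> (0, 0, 0) \<and>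
       finite {(r, s) \<in> R. a * r\<^sup>2 + b * r * s + c * s\<^sup>2 \<noteq> d})"
proof -
  define F where "F = approx_filter R"
  define h x u where "h = (\<lambda>t::int \<times> int. 1 / real_of_int (\<bar>fst t\<bar> + \<bar>snd t\<bar>))"
    and "x = (\<lambda>t::int \<times> int. 1 / real_of_int (snd t))"
    and "u = (\<lambda>t::int \<times> int. real_of_int (fst t) / real_of_int (snd t) - \<alpha>)"
  obtain a b c :: int where "a \<noteq> 0" and root: "a * \<alpha>\<^sup>2 + b * \<alpha> + c = 0"
    and D0: "2 * a * \<alpha> + b \<noteq> 0"
    using quadratic_irrational_root[OF assms(1)] .
  define D where "D = 2 * a * \<alpha> + b"

  have inf: "infinite R" and fin: "finite {(r, s) \<in> R. s = 0}"
    using assms(2) by (auto simp: has_rational_expansion_def)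
  \<comment> \<open>The assumption \<open>\<gamma> 1 = 0\<close> enters here: the error
    \<open>u\<close> has no term linear in \<open>x\<close>.\<close>
  have err: "(\<lambda>t. u t - \<gamma> 2 * x t ^ 2) \<in> o[F](\<lambda>t. h t ^ 2)"
    using assms(2,3)
    by (simp add: has_rational_expansion_def F_def u_def x_def h_def case_prod_unfold
        numeral_2_eq_2 power_divide diff_diff_eq)
  have h0: "(h \<longlongrightarrow> 0) F"
    using tendsto_inverse_height[of R] by (simp add: F_def h_def case_prod_unfold)
  have nz: "eventually (\<lambda>t. snd t \<noteq> 0) F"
    using fin by (simp add: F_def eventually_approx_filter_iff case_prod_unfold)

  \<comment> \<open>Eventually r/s = u + \<alpha> has absolute value at most \<open>C - 1\<close>,
    since \<open>\<bar>x t\<bar> \<le> 1\<close> and \<open>u\<close> is within 1 of its quadratic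
    term. Hence \<open>\<bar>r\<bar> + \<bar>s\<bar> \<le> C * \<bar>s\<bar>\<close>, and the scales
    \<open>h\<close> and \<open>x\<close> are comparable.\<close>
  define C where "C = \<bar>\<alpha>\<bar> + \<bar>\<gamma> 2\<bar> + 2"
  have "((\<lambda>t. h t ^ 2) \<longlongrightarrow> 0) F" using tendsto_power[OF h0, of 2] by simp
  then have "(\<lambda>t. h t ^ 2) \<in> O[F](\<lambda>_. 1)" by (intro bigoI_tendsto[where c = 0]) simp_all
  then have "(\<lambda>t. u t - \<gamma> 2 * x t ^ 2) \<in> o[F](\<lambda>_. 1)"
    using err by (rule landau_o.small_big_trans[rotated])
  then have "eventually (\<lambda>t. \<bar>u t - \<gamma> 2 * x t ^ 2\<bar> \<le> 1) F"
    using landau_o.smallD[of _ F "\<lambda>_. 1::real" 1] by simp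
  then have xh: "eventually (\<lambda>t. \<bar>h t\<bar> \<le> \<bar>x t\<bar> \<and> \<bar>x t\<bar> \<le> C * \<bar>h t\<bar>) F"
    using nz
  proof eventually_elim
    case (elim t)
    define r s where "r = \<bar>real_of_int (fst t)\<bar>" and "s = \<bar>real_of_int (snd t)\<bar>"
    have "\<bar>snd t\<bar> \<ge> 1" using elim(2) by linarith
    then have s: "s \<ge> 1" by (simp add: s_def flip: of_int_abs)
    have r: "r \<ge> 0" by (simp add: r_def)
    have "(x t)\<^sup>2 \<le> 1" using s by (auto simp: abs_square_le_1 x_def s_def)
    then have "\<bar>\<gamma> 2 * x t ^ 2\<bar> \<le> \<bar>\<gamma> 2\<bar>"
      by (simp add: abs_mult mult_left_le)
    then have "\<bar>u t + \<alpha>\<bar> \<le> C - 1" using elim(1) unfolding C_def by linarith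
    moreover have "\<bar>u t + \<alpha>\<bar> = r / s" by (simp add: u_def r_def s_def)
    ultimately have "r \<le> (C - 1) * s" using s by (simp add: divide_le_eq)
    then have "r + s \<le> C * s" by (simp add: algebra_simps)
    moreover have "\<bar>h t\<bar> = 1 / (r + s)" "\<bar>x t\<bar> = 1 / s"
      using r s by (simp_all add: h_def x_def r_def s_def)
    moreover have "1 / (r + s) \<le> 1 / s" "1 / s \<le> C * (1 / (r + s))"
      using r s \<open>r + s \<le> C * s\<close> by (simp_all add: field_simps)
    ultimately show ?case by simp
  qed
  have hx: "h \<in> O[F](x)"
    by (rule landau_o.bigI[of 1]) (use xh in \<open>auto elim: eventually_mono\<close>)
  have xh': "x \<in> O[F](h)"
    by (rule landau_o.bigI[of C]) (use xh in \<open>auto elim: eventually_mono simp: C_def\<close>)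
  have x0: "(x \<longlongrightarrow> 0) F"
    by (rule tendsto_0_le[OF h0, of _ C])
      (use xh in \<open>auto elim: eventually_mono simp: mult.commute\<close>)
  have xnz: "eventually (\<lambda>t. x t \<noteq> 0) F" using nz by (auto elim: eventually_mono simp: x_def)

  \<comment> \<open>With the error measured in \<open>x\<close> instead of \<open>h\<close>,
    division by \<open>x t ^ 2\<close> yields the limit of s^2 u.\<close>
  have "(\<lambda>t. u t - \<gamma> 2 * x t ^ 2) \<in> o[F](\<lambda>t. x t ^ 2)"
    using err landau_o.big_power[OF hx] by (rule landau_o.small_big_trans)
  then have "((\<lambda>t. (u t - \<gamma> 2 * x t ^ 2) / x t ^ 2) \<longlongrightarrow> 0) F" by (rule smalloD_tendsto)
  then have lim: "((\<lambda>t. (u t - \<gamma> 2 * x t ^ 2) / x t ^ 2 + \<gamma> 2) \<longlongrightarrow> 0 + \<gamma> 2) F"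
    by (intro tendsto_add tendsto_const)
  have "eventually (\<lambda>t. (u t - \<gamma> 2 * x t ^ 2) / x t ^ 2 + \<gamma> 2 = u t / x t ^ 2) F"
    using xnz by (auto elim: eventually_mono simp: field_simps)
  with lim have ux2: "((\<lambda>t. u t / x t ^ 2) \<longlongrightarrow> \<gamma> 2) F"
    by (simp add: Lim_transform_eventually)
  have "((\<lambda>t. u t / x t) \<longlongrightarrow> 0) F"
  proof (rule Lim_transform_eventually)
    show "((\<lambda>t. u t / x t ^ 2 * x t) \<longlongrightarrow> 0) F" using tendsto_mult[OF ux2 x0] by simp
    show "eventually (\<lambda>t. u t / x t ^ 2 * x t = u t / x t) F"
      using xnz by (auto elim: eventually_mono simp: power2_eq_square)
  qed
  then have ux: "u \<in> O[F](x)" using xnz by (intro bigoI_tendsto)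
  have u0: "(u \<longlongrightarrow> 0) F"
  proof (rule Lim_transform_eventually)
    show "((\<lambda>t. u t / x t ^ 2 * x t ^ 2) \<longlongrightarrow> 0) F"
      using tendsto_mult[OF ux2 tendsto_power[OF x0, of 2]] by simp
    show "eventually (\<lambda>t. u t / x t ^ 2 * x t ^ 2 = u t) F"
      using xnz by (auto elim: eventually_mono)
  qed

  define q where "q = (\<lambda>t. a * (fst t)\<^sup>2 + b * fst t * snd t + c * (snd t)\<^sup>2)"
  have q_eq: "eventually (\<lambda>t. D * (u t / x t ^ 2) + a * u t * (u t / x t ^ 2) = real_of_int (q t)) F"
    using nz
  proof eventually_elim
    case (elim t)
    define r s where "r = real_of_int (fst t)" and "s = real_of_int (snd t)"
    have s: "s \<noteq> 0" using elim by (simp add: s_def)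
    have u: "u t * s = r - \<alpha> * s" using s by (simp add: u_def r_def s_def field_simps)
    have "D * (u t / x t ^ 2) + a * u t * (u t / x t ^ 2) = D * (u t * s) * s + a * (u t * s)\<^sup>2"
      by (simp add: x_def s_def power2_eq_square)
    also have "\<dots> = a * r\<^sup>2 + b * r * s - (a * \<alpha>\<^sup>2 + b * \<alpha>) * s\<^sup>2"
      unfolding u D_def by (simp add: algebra_simps power2_eq_square)
    also have "a * \<alpha>\<^sup>2 + b * \<alpha> = - c" using root by linarith
    finally show ?case by (simp add: q_def r_def s_def)
  qed
  \<comment> \<open>The term with \<open>a\<close> dies out because \<open>u\<close> tends to 0
    while s^2 u stays bounded.\<close>
  have "((\<lambda>t. D * (u t / x t ^ 2) + a * u t * (u t / x t ^ 2)) \<longlongrightarrow> D * \<gamma> 2 + of_int a * 0 * \<gamma> 2) F"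
    by (intro tendsto_intros ux2 u0)
  then have "((\<lambda>t. real_of_int (q t)) \<longlongrightarrow> D * \<gamma> 2 + of_int a * 0 * \<gamma> 2) F"
    using q_eq by (rule Lim_transform_eventually)
  then obtain d where d: "eventually (\<lambda>t. q t = d) F"
    by (rule tendsto_of_int_eventually_const)

  \<comment> \<open>Multiplying q = d by \<open>x t ^ 2\<close> gives the equation to be
    iterated.\<close>
  have quad: "eventually (\<lambda>t. a * u t ^ 2 + D * u t = d * x t ^ 2) F"
    using q_eq d xnz by eventually_elim (auto simp: field_simps power2_eq_square)
  have "has_rational_expansion N (coeff P) \<alpha> R"
    if P0: "coeff P 0 = 0" and P: "(\<lambda>t. u t - poly P (x t)) \<in> O[F](\<lambda>t. x t ^ Suc N)" for N P
  proof -
    \<comment> \<open>\<open>P\<close> may have degree above \<open>N\<close>. The cutoff keeps the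
      exponents 0 to \<open>N\<close>, and \<open>P0\<close> removes the exponent 0, which the
      expansion does not contain.\<close>
    have cut: "poly (poly_cutoff (Suc N) P) y = (\<Sum>k=1..N. coeff P k * y ^ k)" for y
    proof -
      have "poly_cutoff (Suc N) P = (\<Sum>k\<le>N. monom (coeff P k) k)"
        by (rule poly_eqI) (simp add: coeff_poly_cutoff coeff_sum less_Suc_eq_le)
      then have "poly (poly_cutoff (Suc N) P) y = (\<Sum>k\<le>N. coeff P k * y ^ k)"
        by (simp add: poly_sum poly_monom)
      also have "\<dots> = (\<Sum>k\<in>{1..N}. coeff P k * y ^ k)"
        by (rule sum.mono_neutral_cong_right) (auto simp: P0 not_less_eq_eq)
      finally show ?thesis .
    qed
    have "(\<lambda>t. u t - poly (poly_cutoff (Suc N) P) (x t)) \<in> O[F](\<lambda>t. x t ^ Suc N)"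
      using sum_in_bigo(1)[OF P poly_minus_cutoff_bigo[OF x0, of P "Suc N"]] by simp
    \<comment> \<open>The spare power of \<open>x\<close> becomes a factor \<open>h\<close>, whose
      convergence to 0 turns the big-O bound into the required little-o.\<close>
    also have "(\<lambda>t. x t ^ Suc N) \<in> O[F](\<lambda>t. h t * h t ^ N)"
      using landau_o.big_power[OF xh', of "Suc N"] by simp
    also have "(\<lambda>t. h t * h t ^ N) \<in> o[F](\<lambda>t. 1 * h t ^ N)"
      by (intro landau_o.small_big_mult smalloI_tendsto) (use h0 in simp_all)
    finally show ?thesis
      using inf fin
      by (simp add: has_rational_expansion_def cut u_def x_def h_def case_prod_unfold F_def
          power_divide diff_diff_eq)
  qed
  moreover have "\<exists>P. coeff P 0 = 0 \<and> (\<lambda>t. u t - poly P (x t)) \<in> O[F](\<lambda>t. x t ^ Suc N)" for N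
    using quadratic_solution_expansion[OF x0 ux _ quad] D0 by (simp add: D_def)
  ultimately have "infinite_order_rational_approximation \<alpha> R"
    unfolding infinite_order_rational_approximation_def rational_approximation_def by blast
  moreover have "finite {(r, s) \<in> R. a * r\<^sup>2 + b * r * s + c * s\<^sup>2 \<noteq> d}"
    using d by (simp add: F_def q_def eventually_approx_filter_iff case_prod_unfold)
  ultimately show ?thesis using \<open>a \<noteq> 0\<close> by blast
qed

end
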